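(* Let $m\ge 3$ and let $C_1,C_2,\ldots,C_m$ be $n\times n$ real symmetric matrices with $C_1$ invertible. Suppose that for each $i=2,\ldots,m$ the matrix $C_1^{-1}C_i$ is real similarly diagonalizable, and that $C_jC_1^{-1}C_i$ is symmetric for all $2\le i<j\le m$. Then there exist a nonsingular real $n\times n$ matrix $R$, a positive integer $s$, nonsingular real symmetric matrices $A_1,\ldots,A_s$ (with sizes summing to $n$), and real numbers $\alpha^i_t$ ($2\le i\le m$, $1\le t\le s$; here $i$ is a superscript index, not a power) such that $$R^TC_1R=\mathrm{diag}(A_1,A_2,\ldots,A_s),\qquad R^TC_iR=\mathrm{diag}(\alpha^i_1A_1,\alpha^i_2A_2,\ldots,\alpha^i_sA_s)\quad (i=2,\ldots,m).$$ Moreover, whenever the collection $\{C_1,\ldots,C_m\}$ is transformed into this form by such a congruence $R$, the collection $\{C_1,\ldots,C_m\}$ is SDC.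
   Context: A collection of $n\times n$ real symmetric matrices $\{C_1,\ldots,C_m\}$ is SDC (simultaneously diagonalizable via congruence) if there is a nonsingular real matrix $P$ such that $P^TC_iP$ is (real) diagonal for every $i$. A real square matrix $M$ is real similarly diagonalizable if there is a nonsingular real matrix $H$ with $H^{-1}MH$ real diagonal. $\mathrm{diag}(\cdot)$ denotes a block diagonal matrix with the listed blocks. *)

theory Defs
  imports Complex_Main "Jordan_Normal_Form.Gauss_Jordan_Elimination"
begin

definition symmetric_mat :: "'a mat \<Rightarrow> bool" where
  "symmetric_mat A \<longleftrightarrow> A\<^sup>T = A"

text \<open>The inverse is meaningful only for invertible square matrices.\<close>

definition inv_mat :: "'a :: field mat \<Rightarrow> 'a mat" where
  "inv_mat A = the (mat_inverse A)"

lemma inv_mat: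
  fixes A :: "'a :: field mat"
  assumes A: "A \<in> carrier_mat n n" and inv: "invertible_mat A"
  shows "inv_mat A \<in> carrier_mat n n" "A * inv_mat A = 1\<^sub>m n" "inv_mat A * A = 1\<^sub>m n"
proof -
  from inv obtain B where AB: "A * B = 1\<^sub>m (dim_row A)" and BA: "B * A = 1\<^sub>m (dim_row B)"
    unfolding invertible_mat_def inverts_mat_def by auto
  have "dim_col B = dim_col (A * B)" "dim_col (B * A) = dim_col A" by simp_all
  hence B: "B \<in> carrier_mat n n" using A AB BA by auto
  have "A \<in> Units (ring_mat TYPE('a) n ())"
    using A B AB BA by (auto simp: Units_def ring_mat_def)
  hence "mat_inverse A \<noteq> None" using mat_inverse(1)[OF A, where b = "()"] by blast
  then obtain C where "mat_inverse A = Some C" by blast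
  with mat_inverse(2)[OF A this]
  show "inv_mat A \<in> carrier_mat n n" "A * inv_mat A = 1\<^sub>m n" "inv_mat A * A = 1\<^sub>m n"
    by (auto simp: inv_mat_def)
qed

definition real_similarly_diagonalizable :: "nat \<Rightarrow> real mat \<Rightarrow> bool" where
  "real_similarly_diagonalizable n M \<longleftrightarrow>
     (\<exists>H \<in> carrier_mat n n. invertible_mat H \<and> diagonal_mat (inv_mat H * M * H))"

text \<open>Simultaneous diagonalizability via congruence.\<close>

definition SDC :: "nat \<Rightarrow> real mat set \<Rightarrow> bool" where
  "SDC n S \<longleftrightarrow>
     (\<exists>P \<in> carrier_mat n n. invertible_mat P \<and> (\<forall>M \<in> S. diagonal_mat (P\<^sup>T * M * P)))"

text \<open>
  The superscript index of the scalars is the first argument of \<open>\<alpha>\<close>. Empty blocks are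
  excluded explicitly, since the library admits invertible matrices of size 0.
\<close>

definition block_form ::
    "nat \<Rightarrow> nat \<Rightarrow> (nat \<Rightarrow> real mat) \<Rightarrow> real mat \<Rightarrow> nat \<Rightarrow> (nat \<Rightarrow> real mat)
      \<Rightarrow> (nat \<Rightarrow> nat \<Rightarrow> real) \<Rightarrow> bool" where
  "block_form n m C R s A \<alpha> \<longleftrightarrow>
     R \<in> carrier_mat n n \<and> invertible_mat R \<and> s \<ge> 1 \<and>
     (\<forall>t \<in> {1..s}. dim_row (A t) \<ge> 1 \<and> square_mat (A t) \<and>
        symmetric_mat (A t) \<and> invertible_mat (A t)) \<and>
     (\<Sum>t = 1..s. dim_row (A t)) = n \<and>
     R\<^sup>T * C 1 * R = diag_block_mat (map A [1..<Suc s]) \<and>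
     (\<forall>i \<in> {2..m}. R\<^sup>T * C i * R = diag_block_mat (map (\<lambda>t. \<alpha> i t \<cdot>\<^sub>m A t) [1..<Suc s]))"

end

theory Submission
  imports Defs "Jordan_Normal_Form.Determinant"
begin

text \<open>
  Put \<open>M\<^sub>i = C\<^sub>1\<inverse> C\<^sub>i\<close> and consider the symmetric, nondegenerate, possibly indefinite
  form \<open>b(x, y) = x \<bullet> C\<^sub>1 y\<close>. Symmetry of \<open>C\<^sub>i = C\<^sub>1 M\<^sub>i\<close> says that \<open>M\<^sub>i\<close> is
  self-adjoint for \<open>b\<close>, and symmetry of \<open>C\<^sub>j C\<^sub>1\<inverse> C\<^sub>i\<close> says that \<open>M\<^sub>i\<close> and \<open>M\<^sub>j\<close>
  commute. The theorem follows once there is a basis of joint eigenvectors of the \<open>M\<^sub>i\<close> that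
  is orthogonal for \<open>b\<close>: with these vectors as the columns of \<open>P\<close>, the matrices
  \<open>P\<^sup>T C\<^sub>1 P\<close> and \<open>P\<^sup>T C\<^sub>i P\<close> have the entries \<open>b(v\<^sub>k, v\<^sub>l)\<close> and
  \<open>\<mu>\<^sub>l b(v\<^sub>k, v\<^sub>l)\<close> for the eigenvalues \<open>\<mu>\<^sub>l\<close> of \<open>M\<^sub>i\<close>, so they are diagonal
  (\<open>simultaneous_congruence\<close>).

  Two ideas give the basis. First, the joint eigenvectors span the space
  (\<open>joint_eigenvectors_span\<close>): a joint eigenvector of some of the matrices is the sum of its
  components in the eigenspaces of one further matrix, and these are joint eigenvectors of the
  enlarged family because the matrices commute. Second, an orthogonal family of fewer than
  \<open>n\<close> anisotropic joint eigenvectors can always be enlarged (\<open>anisotropic_extension\<close>).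
  Subtracting from a joint eigenvector its projections to the family gives a joint eigenvector
  again, since eigenvectors for different eigenvalues are orthogonal. If all the vectors obtained
  in this way were isotropic, polarization would make them orthogonal to each other, hence to the
  whole space, contrary to nondegeneracy.

  So \<open>{C\<^sub>1, \<dots>, C\<^sub>m}\<close> is SDC. A diagonal matrix is block diagonal with blocks of size one,
  and the diagonal of \<open>P\<^sup>T C\<^sub>1 P\<close> has no zero, so \<open>P\<close> itself provides the block form with
  \<open>s = n\<close>. In the second claim the conclusion SDC does not mention \<open>R\<close>, so it holds for
  every block form.
\<close>

section \<open>Matrices as bilinear forms\<close>

lemma mult_mat_zero_vec:
  fixes A :: "real mat"
  assumes "A \<in> carrier_mat n n"
  shows "A *\<^sub>v 0\<^sub>v n = 0\<^sub>v n"
  using assms by (intro eq_vecI) auto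

lemma inverse_of_symmetric_mat:
  fixes A W :: "real mat"
  assumes A: "A \<in> carrier_mat n n" and W: "W \<in> carrier_mat n n"
    and sym: "symmetric_mat A" and AW: "A * W = 1\<^sub>m n"
  shows "symmetric_mat W"
proof -
  have WT: "W\<^sup>T * A = 1\<^sub>m n"
    using arg_cong[OF AW, of transpose_mat] transpose_mult[OF A W] sym
    by (simp add: symmetric_mat_def)
  have "W\<^sup>T = W\<^sup>T * (A * W)" using AW W by simp
  also have "\<dots> = (W\<^sup>T * A) * W" using A W by (simp add: assoc_mult_mat[of _ n n _ n _ n])
  also have "\<dots> = W" using WT W by simp
  finally show ?thesis by (simp add: symmetric_mat_def)
qed

lemma symmetric_mat_scalar_prod:
  fixes A :: "real mat"
  assumes A: "A \<in> carrier_mat n n" and "symmetric_mat A"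
    and x: "x \<in> carrier_vec n" and y: "y \<in> carrier_vec n"
  shows "x \<bullet> (A *\<^sub>v y) = y \<bullet> (A *\<^sub>v x)"
proof -
  have "x \<bullet> (A *\<^sub>v y) = (A\<^sup>T *\<^sub>v x) \<bullet> y"
    using transpose_vec_mult_scalar[OF A y x] by simp
  also have "\<dots> = y \<bullet> (A *\<^sub>v x)"
    using assms comm_scalar_prod[of "A *\<^sub>v x" n y] by (simp add: symmetric_mat_def)
  finally show ?thesis .
qed

lemma vec_zero_if_orthogonal_to_all:
  fixes x :: "real vec"
  assumes x: "x \<in> carrier_vec n" and "\<And>z. z \<in> carrier_vec n \<Longrightarrow> x \<bullet> z = 0"
  shows "x = 0\<^sub>v n"
proof (rule eq_vecI)
  fix k assume "k < dim_vec (0\<^sub>v n :: real vec)"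
  then show "x $ k = 0\<^sub>v n $ k"
    using assms(2)[of "unit_vec n k"] x by simp
qed (use x in simp)

text \<open>
  Padded with zero rows, the \<open>r\<close> equations form a square matrix. It is singular because its
  transpose annihilates the unit vector of row \<open>r\<close>.
\<close>

lemma kernel_vector_if_fewer_equations:
  fixes B :: "real mat" and v :: "nat \<Rightarrow> real vec"
  assumes B: "B \<in> carrier_mat n n" and r: "r < n"
    and v: "\<And>k. k < r \<Longrightarrow> v k \<in> carrier_vec n"
  obtains y where "y \<in> carrier_vec n" "y \<noteq> 0\<^sub>v n" "\<And>k. k < r \<Longrightarrow> v k \<bullet> y = 0"
proof -
  define V where "V = mat_of_rows n (map (\<lambda>k. if k < r then v k else 0\<^sub>v n) [0..<n])"
  have V: "V \<in> carrier_mat n n" unfolding V_def by (rule carrier_matI) auto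
  have row: "row V k = (if k < r then v k else 0\<^sub>v n)" if "k < n" for k
    unfolding V_def using that v by (subst mat_of_rows_row) auto
  have "V\<^sup>T *\<^sub>v unit_vec n r = 0\<^sub>v n"
  proof (rule eq_vecI)
    fix k assume "k < dim_vec (0\<^sub>v n :: real vec)"
    then have k: "k < n" by simp
    have "(V\<^sup>T *\<^sub>v unit_vec n r) $ k = row V r $ k"
      using k r V by (simp add: scalar_prod_right_unit)
    then show "(V\<^sup>T *\<^sub>v unit_vec n r) $ k = 0\<^sub>v n $ k"
      using row[OF r] k by simp
  qed (use V in simp)
  moreover have "unit_vec n r \<noteq> (0\<^sub>v n :: real vec)"
    using r by (metis index_unit_vec(1) index_zero_vec(1) zero_neq_one)
  ultimately have "det V\<^sup>T = 0"
    using det_0_iff_vec_prod_zero[of "V\<^sup>T" n] V unit_vec_carrier[of n r] by fastforce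
  then have "det V = 0" using det_transpose[OF V] by simp
  then obtain y where y: "y \<in> carrier_vec n" "y \<noteq> 0\<^sub>v n" "V *\<^sub>v y = 0\<^sub>v n"
    using det_0_iff_vec_prod_zero[OF V] by auto
  have "v k \<bullet> y = 0" if "k < r" for k
  proof -
    have "(V *\<^sub>v y) $ k = row V k \<bullet> y" using that r V by simp
    then show ?thesis using row[of k] that r y(3) by simp
  qed
  with y show thesis using that by blast
qed

section \<open>Joint eigenvectors of commuting diagonalizable matrices\<close>

text \<open>
  The zero vector is included, so that this is a subspace for every choice of the eigenvalues
  \<open>\<mu>\<close>; it is trivial for all but finitely many values of \<open>\<mu>\<close> on \<open>I\<close>.
\<close>

definition joint_eigenspace ::
    "nat \<Rightarrow> 'i set \<Rightarrow> ('i \<Rightarrow> real mat) \<Rightarrow> ('i \<Rightarrow> real) \<Rightarrow> real vec set" where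
  "joint_eigenspace n I M \<mu> = {v \<in> carrier_vec n. \<forall>i\<in>I. M i *\<^sub>v v = \<mu> i \<cdot>\<^sub>v v}"

lemma joint_eigenspace_add:
  assumes "\<And>i. i \<in> I \<Longrightarrow> M i \<in> carrier_mat n n"
    and "u \<in> joint_eigenspace n I M \<mu>" "w \<in> joint_eigenspace n I M \<mu>"
  shows "u + w \<in> joint_eigenspace n I M \<mu>"
  using assms
  by (auto simp: joint_eigenspace_def mult_add_distrib_mat_vec[of _ n n] smult_add_distrib_vec)

lemma joint_eigenspace_smult:
  assumes "\<And>i. i \<in> I \<Longrightarrow> M i \<in> carrier_mat n n"
    and "u \<in> joint_eigenspace n I M \<mu>"
  shows "c \<cdot>\<^sub>v u \<in> joint_eigenspace n I M \<mu>"
  using assms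
  by (auto simp: joint_eigenspace_def mult_mat_vec[of _ n n] smult_smult_assoc mult.commute)

lemma commute_diagonal_entry:
  fixes X D :: "real mat"
  assumes X: "X \<in> carrier_mat n n" and D: "D \<in> carrier_mat n n" "diagonal_mat D"
    and comm: "X * D = D * X" and k: "k < n" and l: "l < n" and nz: "X $$ (k, l) \<noteq> 0"
  shows "D $$ (k, k) = D $$ (l, l)"
proof -
  have "(X * D) $$ (k, l) = (\<Sum>j<n. X $$ (k, j) * D $$ (j, l))"
    using X D k l by (simp add: scalar_prod_def lessThan_atLeast0)
  also have "\<dots> = (\<Sum>j<n. if j = l then X $$ (k, l) * D $$ (l, l) else 0)"
    using D l by (intro sum.cong) (auto simp: diagonal_mat_def)
  also have "\<dots> = X $$ (k, l) * D $$ (l, l)" using l by simp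
  finally have 1: "(X * D) $$ (k, l) = X $$ (k, l) * D $$ (l, l)" .
  have "(D * X) $$ (k, l) = (\<Sum>j<n. D $$ (k, j) * X $$ (j, l))"
    using X D k l by (simp add: scalar_prod_def lessThan_atLeast0)
  also have "\<dots> = (\<Sum>j<n. if j = k then D $$ (k, k) * X $$ (k, l) else 0)"
    using D k by (intro sum.cong) (auto simp: diagonal_mat_def)
  also have "\<dots> = D $$ (k, k) * X $$ (k, l)" using k by simp
  finally show ?thesis using 1 comm nz by simp
qed

text \<open>The projection of \<open>x\<close> to the \<open>\<nu>\<close>-eigenspace of a diagonal matrix \<open>D\<close>.\<close>

definition spectral_component :: "real mat \<Rightarrow> real \<Rightarrow> real vec \<Rightarrow> real vec" where
  "spectral_component D \<nu> x = vec (dim_vec x) (\<lambda>k. if D $$ (k, k) = \<nu> then x $ k else 0)"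

lemma spectral_component_carrier:
  "x \<in> carrier_vec n \<Longrightarrow> spectral_component D \<nu> x \<in> carrier_vec n"
  by (simp add: spectral_component_def)

text \<open>
  A matrix commuting with \<open>D\<close> has no entries between different eigenspaces of \<open>D\<close>, so it
  commutes with the spectral projections of \<open>D\<close>.
\<close>

lemma spectral_component_eigenvector:
  fixes X D :: "real mat" and x :: "real vec"
  assumes X: "X \<in> carrier_mat n n" and D: "D \<in> carrier_mat n n" "diagonal_mat D"
    and comm: "X * D = D * X" and x: "x \<in> carrier_vec n" and eig: "X *\<^sub>v x = c \<cdot>\<^sub>v x"
  shows "X *\<^sub>v spectral_component D \<nu> x = c \<cdot>\<^sub>v spectral_component D \<nu> x" (is "X *\<^sub>v ?z = _")
proof (rule eq_vecI)
  fix k assume "k < dim_vec (c \<cdot>\<^sub>v ?z)"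
  then have k: "k < n" using x by (simp add: spectral_component_def)
  have "(X *\<^sub>v ?z) $ k = (\<Sum>l<n. X $$ (k, l) * (if D $$ (l, l) = \<nu> then x $ l else 0))"
    using X k x by (simp add: spectral_component_def scalar_prod_def lessThan_atLeast0)
  also have "\<dots> = (\<Sum>l<n. if D $$ (k, k) = \<nu> then X $$ (k, l) * x $ l else 0)"
    using commute_diagonal_entry[OF X D comm k] by (intro sum.cong) fastforce+
  also have "\<dots> = (if D $$ (k, k) = \<nu> then (X *\<^sub>v x) $ k else 0)"
    using X k x by (simp add: scalar_prod_def lessThan_atLeast0)
  also have "\<dots> = (c \<cdot>\<^sub>v ?z) $ k" using eig k x by (simp add: spectral_component_def)
  finally show "(X *\<^sub>v ?z) $ k = (c \<cdot>\<^sub>v ?z) $ k" .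
qed (use X x in \<open>simp add: spectral_component_def\<close>)

lemma diagonal_mult_spectral_component:
  fixes D :: "real mat"
  assumes D: "D \<in> carrier_mat n n" "diagonal_mat D" and x: "x \<in> carrier_vec n"
  shows "D *\<^sub>v spectral_component D \<nu> x = \<nu> \<cdot>\<^sub>v spectral_component D \<nu> x" (is "D *\<^sub>v ?z = _")
proof (rule eq_vecI)
  fix k assume "k < dim_vec (\<nu> \<cdot>\<^sub>v ?z)"
  then have k: "k < n" using x by (simp add: spectral_component_def)
  have "(D *\<^sub>v ?z) $ k = (\<Sum>l<n. D $$ (k, l) * (if D $$ (l, l) = \<nu> then x $ l else 0))"
    using D k x by (simp add: spectral_component_def scalar_prod_def lessThan_atLeast0)
  also have "\<dots> = (\<Sum>l<n. if l = k then D $$ (k, k) * ?z $ k else 0)"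
    using D k x by (intro sum.cong) (auto simp: diagonal_mat_def spectral_component_def)
  also have "\<dots> = D $$ (k, k) * ?z $ k" using k by simp
  also have "\<dots> = (\<nu> \<cdot>\<^sub>v ?z) $ k" using k x by (simp add: spectral_component_def)
  finally show "(D *\<^sub>v ?z) $ k = (\<nu> \<cdot>\<^sub>v ?z) $ k" .
qed (use D x in \<open>simp add: spectral_component_def\<close>)

text \<open>
  The inductive step for the spanning property. In coordinates that diagonalize \<open>M j\<close>, the
  vector \<open>v\<close> is the sum of its spectral components, each of which is a joint eigenvector of
  the family enlarged by \<open>j\<close>. A vector orthogonal to all components is orthogonal to \<open>v\<close>.
\<close>

lemma orthogonal_to_joint_eigenspace_insert:
  fixes M :: "'i \<Rightarrow> real mat"
  assumes M: "\<And>i. i \<in> insert j I \<Longrightarrow> M i \<in> carrier_mat n n"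
    and comm: "\<And>i. i \<in> I \<Longrightarrow> M i * M j = M j * M i"
    and diag: "real_similarly_diagonalizable n (M j)"
    and y: "y \<in> carrier_vec n"
    and orth: "\<And>\<mu> v. v \<in> joint_eigenspace n (insert j I) M \<mu> \<Longrightarrow> y \<bullet> v = 0"
    and v: "v \<in> joint_eigenspace n I M \<mu>"
  shows "y \<bullet> v = 0"
proof -
  obtain H where H: "H \<in> carrier_mat n n" and invH: "invertible_mat H"
    and dg: "diagonal_mat (inv_mat H * M j * H)"
    using diag unfolding real_similarly_diagonalizable_def by blast
  define G where "G = inv_mat H"
  have G: "G \<in> carrier_mat n n" and HG: "H * G = 1\<^sub>m n"
    unfolding G_def using inv_mat[OF H invH] by auto
  have Mj: "M j \<in> carrier_mat n n" using M by simp
  define conj where "conj A = G * A * H" for A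
  have conj_carrier: "conj A \<in> carrier_mat n n" if "A \<in> carrier_mat n n" for A
    unfolding conj_def using that G H by simp
  have conj_mult: "conj A * conj A' = conj (A * A')"
    if A: "A \<in> carrier_mat n n" and A': "A' \<in> carrier_mat n n" for A A'
  proof -
    have "conj A * conj A' = G * A * (H * G) * A' * H"
      unfolding conj_def using A A' G H by (simp add: assoc_mult_mat[of _ n n _ n _ n])
    then show ?thesis unfolding conj_def HG using A A' G H
      by (simp add: assoc_mult_mat[of _ n n _ n _ n])
  qed
  have conj_apply: "A *\<^sub>v (H *\<^sub>v z) = H *\<^sub>v (conj A *\<^sub>v z)"
    if A: "A \<in> carrier_mat n n" and z: "z \<in> carrier_vec n" for A z
  proof -
    have "H *\<^sub>v (conj A *\<^sub>v z) = (H * G) *\<^sub>v (A *\<^sub>v (H *\<^sub>v z))"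
      unfolding conj_def using A G H z by (simp add: assoc_mult_mat_vec[of _ n n _ n])
    then show ?thesis unfolding HG using A H z by simp
  qed
  define D where "D = conj (M j)"
  have D: "D \<in> carrier_mat n n" "diagonal_mat D"
    using conj_carrier[OF Mj] dg by (auto simp: D_def conj_def G_def)
  have vc: "v \<in> carrier_vec n" using v by (simp add: joint_eigenspace_def)
  define x where "x = G *\<^sub>v v"
  have x: "x \<in> carrier_vec n" unfolding x_def using G vc by simp
  have vx: "v = H *\<^sub>v x"
    unfolding x_def using assoc_mult_mat_vec[OF H G vc] HG vc by simp
  define comp where "comp \<nu> = spectral_component D \<nu> x" for \<nu>
  have comp: "comp \<nu> \<in> carrier_vec n" for \<nu>
    unfolding comp_def by (rule spectral_component_carrier[OF x])
  have in_insert: "H *\<^sub>v comp \<nu> \<in> joint_eigenspace n (insert j I) M (\<mu>(j := \<nu>))" for \<nu>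
    unfolding joint_eigenspace_def
  proof (intro CollectI conjI ballI)
    show "H *\<^sub>v comp \<nu> \<in> carrier_vec n" using H comp by simp
    fix i assume i: "i \<in> insert j I"
    show "M i *\<^sub>v (H *\<^sub>v comp \<nu>) = (\<mu>(j := \<nu>)) i \<cdot>\<^sub>v (H *\<^sub>v comp \<nu>)"
    proof (cases "i = j")
      case True
      have "conj (M j) *\<^sub>v comp \<nu> = \<nu> \<cdot>\<^sub>v comp \<nu>"
        unfolding D_def[symmetric] comp_def
        by (rule diagonal_mult_spectral_component[OF D x])
      then show ?thesis
        using True conj_apply[OF Mj comp] mult_mat_vec[OF H comp] by simp
    next
      case False
      with i have iI: "i \<in> I" by simp
      have Mi: "M i \<in> carrier_mat n n" using M i .
      have X: "conj (M i) *\<^sub>v x = \<mu> i \<cdot>\<^sub>v x"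
      proof -
        have "conj (M i) *\<^sub>v x = G *\<^sub>v (M i *\<^sub>v v)"
          unfolding conj_def vx using Mi G H x by (simp add: assoc_mult_mat_vec[of _ n n _ n])
        also have "M i *\<^sub>v v = \<mu> i \<cdot>\<^sub>v v" using v iI by (simp add: joint_eigenspace_def)
        finally show ?thesis using mult_mat_vec[OF G vc] by (simp add: x_def)
      qed
      have "conj (M i) *\<^sub>v comp \<nu> = \<mu> i \<cdot>\<^sub>v comp \<nu>"
        unfolding comp_def
      proof (rule spectral_component_eigenvector[OF conj_carrier[OF Mi] D _ x X])
        show "conj (M i) * D = D * conj (M i)"
          unfolding D_def using conj_mult Mi Mj comm[OF iI] by simp
      qed
      then show ?thesis
        using False conj_apply[OF Mi comp] mult_mat_vec[OF H comp] by simp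
    qed
  qed
  \<comment> \<open>In the new coordinates \<open>y\<close> becomes the covector \<open>g\<close>; its pairing with \<open>x\<close> is
      grouped by the eigenvalues of \<open>M j\<close>.\<close>
  define g where "g = H\<^sup>T *\<^sub>v y"
  have gs: "y \<bullet> (H *\<^sub>v z) = (\<Sum>k<n. g $ k * z $ k)" if z: "z \<in> carrier_vec n" for z
    using transpose_vec_mult_scalar[OF H z y] z
    by (simp add: g_def scalar_prod_def lessThan_atLeast0)
  have zero: "(\<Sum>k\<in>{k. k < n \<and> D $$ (k, k) = \<nu>}. g $ k * x $ k) = 0" for \<nu>
  proof -
    have "(\<Sum>k\<in>{k. k < n \<and> D $$ (k, k) = \<nu>}. g $ k * x $ k)
        = (\<Sum>k<n. if D $$ (k, k) = \<nu> then g $ k * x $ k else 0)"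
      by (simp add: sum.If_cases Int_def)
    also have "\<dots> = (\<Sum>k<n. g $ k * comp \<nu> $ k)"
      using x by (intro sum.cong) (auto simp: comp_def spectral_component_def)
    also have "\<dots> = y \<bullet> (H *\<^sub>v comp \<nu>)" using gs[OF comp] by simp
    also have "\<dots> = 0" using orth[OF in_insert] .
    finally show ?thesis .
  qed
  have "y \<bullet> v = (\<Sum>k<n. g $ k * x $ k)" unfolding vx by (rule gs[OF x])
  also have "\<dots> = (\<Sum>\<nu>\<in>(\<lambda>k. D $$ (k, k)) ` {..<n}.
      \<Sum>k\<in>{k \<in> {..<n}. D $$ (k, k) = \<nu>}. g $ k * x $ k)"
    by (rule sum.image_gen) simp
  also have "\<dots> = 0" using zero by simp
  finally show ?thesis .
qed

text \<open>
  Spanning is expressed dually, by the vanishing of the orthogonal complement: this avoids linear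
  combinations and is the form in which the property is used below.
\<close>

lemma joint_eigenvectors_span:
  fixes M :: "'i \<Rightarrow> real mat"
  assumes "finite I"
    and M: "\<And>i. i \<in> I \<Longrightarrow> M i \<in> carrier_mat n n"
    and diag: "\<And>i. i \<in> I \<Longrightarrow> real_similarly_diagonalizable n (M i)"
    and comm: "\<And>i j. i \<in> I \<Longrightarrow> j \<in> I \<Longrightarrow> M i * M j = M j * M i"
    and y: "y \<in> carrier_vec n"
    and orth: "\<And>\<mu> v. v \<in> joint_eigenspace n I M \<mu> \<Longrightarrow> y \<bullet> v = 0"
  shows "y = 0\<^sub>v n"
  using assms(1) M diag comm orth
proof (induction I rule: finite_induct)
  case empty
  then show ?case
    by (intro vec_zero_if_orthogonal_to_all[OF y]) (simp add: joint_eigenspace_def)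
next
  case (insert j I)
  show ?case
  proof (rule insert.IH)
    fix \<mu> v assume v: "v \<in> joint_eigenspace n I M \<mu>"
    show "y \<bullet> v = 0"
    proof (rule orthogonal_to_joint_eigenspace_insert[OF _ _ _ y _ v])
      show "M i * M j = M j * M i" if "i \<in> I" for i
        using that by (intro insert.prems(3)) simp_all
    qed (use insert.prems(1,2,4) in simp_all)
  next
    show "M i * M k = M k * M i" if "i \<in> I" "k \<in> I" for i k
      using that by (intro insert.prems(3)) simp_all
  qed (use insert.prems(1,2) in simp_all)
qed

section \<open>Orthogonal bases of joint eigenvectors\<close>

text \<open>
  The matrix \<open>B\<close> plays the role of \<open>C\<^sub>1\<close>. Symmetry of \<open>B * M i\<close> is self-adjointness of
  \<open>M i\<close> for the form defined by \<open>B\<close>.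
\<close>

locale selfadjoint_family =
  fixes n :: nat and B :: "real mat" and I :: "'i set" and M :: "'i \<Rightarrow> real mat"
  assumes B: "B \<in> carrier_mat n n" and B_sym: "symmetric_mat B" and B_inv: "invertible_mat B"
    and M: "\<And>i. i \<in> I \<Longrightarrow> M i \<in> carrier_mat n n"
    and BM_sym: "\<And>i. i \<in> I \<Longrightarrow> symmetric_mat (B * M i)"
    and span: "\<And>y. y \<in> carrier_vec n \<Longrightarrow>
      (\<And>\<mu> v. v \<in> joint_eigenspace n I M \<mu> \<Longrightarrow> y \<bullet> v = 0) \<Longrightarrow> y = 0\<^sub>v n"
begin

abbreviation "E \<equiv> joint_eigenspace n I M"

abbreviation form :: "real vec \<Rightarrow> real vec \<Rightarrow> real" where
  "form x y \<equiv> x \<bullet> (B *\<^sub>v y)"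

lemma E_carrier: "v \<in> E \<mu> \<Longrightarrow> v \<in> carrier_vec n"
  by (simp add: joint_eigenspace_def)

lemma form_sym: "x \<in> carrier_vec n \<Longrightarrow> y \<in> carrier_vec n \<Longrightarrow> form x y = form y x"
  by (rule symmetric_mat_scalar_prod[OF B B_sym])

lemma form_add_right:
  "x \<in> carrier_vec n \<Longrightarrow> y \<in> carrier_vec n \<Longrightarrow> z \<in> carrier_vec n \<Longrightarrow>
    form x (y + z) = form x y + form x z"
  using B by (simp add: mult_add_distrib_mat_vec[OF B] scalar_prod_add_distrib[of _ n])

lemma form_smult_right:
  "x \<in> carrier_vec n \<Longrightarrow> y \<in> carrier_vec n \<Longrightarrow> form x (c \<cdot>\<^sub>v y) = c * form x y"
  using B by (simp add: mult_mat_vec[OF B])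

lemma nondegenerate:
  assumes x: "x \<in> carrier_vec n" and "B *\<^sub>v x = 0\<^sub>v n"
  shows "x = 0\<^sub>v n"
proof -
  have "(inv_mat B * B) *\<^sub>v x = inv_mat B *\<^sub>v (B *\<^sub>v x)"
    using inv_mat(1)[OF B B_inv] B x by simp
  then show ?thesis
    using assms inv_mat[OF B B_inv] mult_mat_zero_vec by simp
qed

lemma form_eigenvector:
  assumes x: "x \<in> carrier_vec n" and w: "w \<in> E \<mu>" and i: "i \<in> I"
  shows "x \<bullet> ((B * M i) *\<^sub>v w) = \<mu> i * form x w"
proof -
  have "(B * M i) *\<^sub>v w = \<mu> i \<cdot>\<^sub>v (B *\<^sub>v w)"
    using w i M[OF i] B E_carrier[OF w] mult_mat_vec[OF B E_carrier[OF w]]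
    by (simp add: joint_eigenspace_def)
  then show ?thesis using x B E_carrier[OF w] by simp
qed

lemma eigenspaces_orthogonal:
  assumes v: "v \<in> E \<nu>" and w: "w \<in> E \<mu>" and i: "i \<in> I" and ne: "\<nu> i \<noteq> \<mu> i"
  shows "form v w = 0"
proof -
  have vc: "v \<in> carrier_vec n" and wc: "w \<in> carrier_vec n" using v w E_carrier by auto
  have "\<mu> i * form v w = v \<bullet> ((B * M i) *\<^sub>v w)" using form_eigenvector[OF vc w i] by simp
  also have "\<dots> = w \<bullet> ((B * M i) *\<^sub>v v)"
    using B M[OF i] vc wc by (intro symmetric_mat_scalar_prod[OF _ BM_sym[OF i]]) auto
  also have "\<dots> = \<nu> i * form v w"
    using form_eigenvector[OF wc v i] form_sym[OF vc wc] by simp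
  finally show ?thesis using ne by auto
qed

lemma E_cong: "(\<And>i. i \<in> I \<Longrightarrow> \<nu> i = \<mu> i) \<Longrightarrow> E \<nu> = E \<mu>"
  by (auto simp: joint_eigenspace_def)

text \<open>
  Gram-Schmidt inside one joint eigenspace: \<open>u\<close> is \<open>w\<close> minus its projections to the
  \<open>v k\<close>. It stays in the eigenspace of \<open>w\<close> because only those \<open>v k\<close> contribute that have
  the same eigenvalues as \<open>w\<close>. The last clause records that \<open>w - u\<close> is a combination of the
  \<open>v k\<close>, in the dual form that the extension argument needs. The hypothesis on the values
  of the form says both that the family is orthogonal and that its members are anisotropic.
\<close>

lemma orthogonal_component:
  fixes v :: "nat \<Rightarrow> real vec"
  assumes "\<And>k. k < r \<Longrightarrow> v k \<in> E (\<mu> k)"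
    and "\<And>k l. k < r \<Longrightarrow> l < r \<Longrightarrow> form (v k) (v l) = 0 \<longleftrightarrow> k \<noteq> l"
    and w: "w \<in> E \<nu>"
  shows "\<exists>u \<in> E \<nu>. (\<forall>k<r. form (v k) u = 0) \<and>
    (\<forall>y \<in> carrier_vec n. (\<forall>k<r. form (v k) y = 0) \<longrightarrow> form y w = form y u)"
  using assms(1,2)
proof (induction r)
  case 0
  then show ?case using w by auto
next
  case (Suc r)
  then obtain u where u: "u \<in> E \<nu>" and orth: "\<And>k. k < r \<Longrightarrow> form (v k) u = 0"
    and eq: "\<And>y. y \<in> carrier_vec n \<Longrightarrow> (\<And>k. k < r \<Longrightarrow> form (v k) y = 0) \<Longrightarrow>
      form y w = form y u"
    by (metis less_Suc_eq)
  have uc: "u \<in> carrier_vec n" using E_carrier[OF u] .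
  have vE: "v r \<in> E (\<mu> r)" using Suc.prems(1) by simp
  have vc: "v k \<in> carrier_vec n" if "k \<le> r" for k using Suc.prems(1)[of k] that E_carrier by simp
  have vv: "form (v r) (v r) \<noteq> 0" using Suc.prems(2)[of r r] by simp
  define c where "c = - form (v r) u / form (v r) (v r)"
  define u' where "u' = u + c \<cdot>\<^sub>v v r"
  have form_u': "form y u' = form y u + c * form y (v r)" if "y \<in> carrier_vec n" for y
    unfolding u'_def using form_add_right[of y u "c \<cdot>\<^sub>v v r"] form_smult_right[of y "v r" c]
      that uc vc[of r] by simp
  have "u' \<in> E \<nu>"
  proof (cases "\<forall>i\<in>I. \<mu> r i = \<nu> i")
    case True
    then have "v r \<in> E \<nu>" using vE E_cong[of "\<mu> r" \<nu>] by auto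
    then show ?thesis
      unfolding u'_def using M u by (intro joint_eigenspace_add joint_eigenspace_smult) auto
  next
    case False
    then have "form (v r) u = 0" using eigenspaces_orthogonal[OF vE u] by auto
    then have "u' = u" unfolding u'_def c_def using uc vc[of r] by (intro eq_vecI) auto
    then show ?thesis using u by simp
  qed
  moreover have "form (v k) u' = 0" if k: "k < Suc r" for k
  proof (cases "k = r")
    case True
    then show ?thesis using form_u'[of "v r"] vc vv by (simp add: c_def)
  next
    case False
    then show ?thesis
      using form_u'[of "v k"] vc[of k] k orth[of k] Suc.prems(2)[of k r] by simp
  qed
  moreover have "form y w = form y u'"
    if y: "y \<in> carrier_vec n" and yo: "\<forall>k<Suc r. form (v k) y = 0" for y
  proof -
    have "form y (v r) = 0" using yo form_sym[OF y vc[of r]] by simp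
    then show ?thesis using form_u'[OF y] eq[OF y] yo by simp
  qed
  ultimately show ?case by blast
qed

text \<open>
  Suppose that every joint eigenvector orthogonal to the \<open>v k\<close> is isotropic. By polarization
  inside an eigenspace, and orthogonality of different eigenspaces, any two such vectors are
  orthogonal. So the component \<open>u\<close> of any joint eigenvector \<open>w\<close> is orthogonal to all joint
  eigenvectors, hence zero. Then every \<open>z\<close> orthogonal to the \<open>v k\<close> is orthogonal to all
  joint eigenvectors, hence zero as well; but for \<open>r < n\<close> there is a nonzero such \<open>z\<close>.
\<close>

lemma anisotropic_extension:
  assumes r: "r < n" and v: "\<And>k. k < r \<Longrightarrow> v k \<in> E (\<mu> k)"
    and orth: "\<And>k l. k < r \<Longrightarrow> l < r \<Longrightarrow> form (v k) (v l) = 0 \<longleftrightarrow> k \<noteq> l"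
  shows "\<exists>\<nu>. \<exists>u \<in> E \<nu>. (\<forall>k<r. form (v k) u = 0) \<and> form u u \<noteq> 0"
proof (rule ccontr)
  assume "\<not> ?thesis"
  then have iso: "form u u = 0" if "u \<in> E \<nu>" "\<And>k. k < r \<Longrightarrow> form (v k) u = 0" for u \<nu>
    using that by blast
  have vc: "v k \<in> carrier_vec n" if "k < r" for k using v[OF that] E_carrier by simp
  have null: "form u u' = 0"
    if u: "u \<in> E \<nu>" and uo: "\<And>k. k < r \<Longrightarrow> form (v k) u = 0"
      and u': "u' \<in> E \<nu>'" and u'o: "\<And>k. k < r \<Longrightarrow> form (v k) u' = 0" for u \<nu> u' \<nu>'
  proof (cases "\<forall>i\<in>I. \<nu>' i = \<nu> i")
    case False
    then show ?thesis using eigenspaces_orthogonal[OF u u'] by auto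
  next
    case True
    then have u'2: "u' \<in> E \<nu>" using u' E_cong[of \<nu>' \<nu>] by auto
    have uc: "u \<in> carrier_vec n" and u'c: "u' \<in> carrier_vec n" using u u' E_carrier by auto
    have "form (u + u') (u + u') = 0"
    proof (rule iso)
      show "u + u' \<in> E \<nu>" using M u u'2 by (intro joint_eigenspace_add) auto
    qed (use form_add_right vc uc u'c uo u'o in simp)
    moreover have "form (u + u') (u + u') = form u u + 2 * form u u' + form u' u'"
    proof -
      have "form (u + u') (u + u') = form (u + u') u + form (u + u') u'"
        using uc u'c by (intro form_add_right) auto
      moreover have "form (u + u') z = form z u + form z u'" if "z \<in> carrier_vec n" for z
        using form_sym[of "u + u'" z] form_add_right[of z u u'] that uc u'c by simp
      ultimately show ?thesis using uc u'c form_sym[OF u'c uc] by simp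
    qed
    ultimately show ?thesis using iso[OF u uo] iso[OF u'2 u'o] by simp
  qed
  obtain z where z: "z \<in> carrier_vec n" "z \<noteq> 0\<^sub>v n" "\<And>k. k < r \<Longrightarrow> v k \<bullet> (B *\<^sub>v z) = 0"
  proof -
    have Bv: "B *\<^sub>v v k \<in> carrier_vec n" if "k < r" for k using B vc[OF that] by simp
    obtain z where z: "z \<in> carrier_vec n" "z \<noteq> 0\<^sub>v n" "\<And>k. k < r \<Longrightarrow> (B *\<^sub>v v k) \<bullet> z = 0"
      using kernel_vector_if_fewer_equations[OF B r, of "\<lambda>k. B *\<^sub>v v k"] Bv by blast
    have "form (v k) z = 0" if k: "k < r" for k
      using z(3)[OF k] form_sym[OF vc[OF k] z(1)] comm_scalar_prod[OF Bv[OF k] z(1)] by simp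
    then show thesis using that z by blast
  qed
  have component: "\<exists>u \<in> E \<nu>. (\<forall>k<r. form (v k) u = 0) \<and>
      (\<forall>y \<in> carrier_vec n. (\<forall>k<r. form (v k) y = 0) \<longrightarrow> form y w = form y u)"
    if "w \<in> E \<nu>" for \<nu> w
    by (rule orthogonal_component[where \<mu> = \<mu>]) (fact v orth that)+
  have "B *\<^sub>v z = 0\<^sub>v n"
  proof (rule span)
    show "B *\<^sub>v z \<in> carrier_vec n" using B z by simp
    fix \<nu> w assume w: "w \<in> E \<nu>"
    have wc: "w \<in> carrier_vec n" using E_carrier[OF w] .
    obtain u where u: "u \<in> E \<nu>" "\<And>k. k < r \<Longrightarrow> form (v k) u = 0"
      and zu: "\<And>y. y \<in> carrier_vec n \<Longrightarrow> (\<And>k. k < r \<Longrightarrow> form (v k) y = 0) \<Longrightarrow>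
        form y w = form y u"
      using component[OF w] by metis
    have uc: "u \<in> carrier_vec n" using E_carrier[OF u(1)] .
    have "B *\<^sub>v u = 0\<^sub>v n"
    proof (rule span)
      show Buc: "B *\<^sub>v u \<in> carrier_vec n" using B uc by simp
      fix \<nu>' x assume x: "x \<in> E \<nu>'"
      have xc: "x \<in> carrier_vec n" using E_carrier[OF x] .
      obtain u' where u': "u' \<in> E \<nu>'" "\<And>k. k < r \<Longrightarrow> form (v k) u' = 0"
        and xu: "\<And>y. y \<in> carrier_vec n \<Longrightarrow> (\<And>k. k < r \<Longrightarrow> form (v k) y = 0) \<Longrightarrow>
          form y x = form y u'"
        using component[OF x] by metis
      have "(B *\<^sub>v u) \<bullet> x = form u x"
        using comm_scalar_prod[OF Buc xc] form_sym[OF xc uc] by simp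
      then show "(B *\<^sub>v u) \<bullet> x = 0" using xu[OF uc u(2)] null[OF u u'] by simp
    qed
    then have "form z w = 0"
      using zu[OF z(1) z(3)] z(1) by simp
    then show "(B *\<^sub>v z) \<bullet> w = 0"
      using comm_scalar_prod[of "B *\<^sub>v z" n w] form_sym[OF wc z(1)] B z(1) wc by simp
  qed
  then show False using nondegenerate[OF z(1)] z(2) by simp
qed

lemma orthogonal_family_exists:
  assumes "r \<le> n"
  shows "\<exists>v \<mu>. (\<forall>k<r. v k \<in> E (\<mu> k)) \<and>
    (\<forall>k<r. \<forall>l<r. form (v k) (v l) = 0 \<longleftrightarrow> k \<noteq> l)"
  using assms
proof (induction r)
  case 0
  then show ?case by simp
next
  case (Suc r)
  then obtain v \<mu> where v: "\<And>k. k < r \<Longrightarrow> v k \<in> E (\<mu> k)"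
    and orth: "\<And>k l. k < r \<Longrightarrow> l < r \<Longrightarrow> form (v k) (v l) = 0 \<longleftrightarrow> k \<noteq> l"
    by auto
  obtain \<nu> u where u: "u \<in> E \<nu>" "\<And>k. k < r \<Longrightarrow> form (v k) u = 0" "form u u \<noteq> 0"
  proof -
    have "\<exists>\<nu>. \<exists>u \<in> E \<nu>. (\<forall>k<r. form (v k) u = 0) \<and> form u u \<noteq> 0"
    proof (rule anisotropic_extension[where \<mu> = \<mu>])
      show "r < n" using Suc.prems by simp
    qed (fact v orth)+
    then show thesis using that by metis
  qed
  have "form u (v k) = 0" if "k < r" for k
    using form_sym[of u "v k"] u(2)[OF that] E_carrier u(1) v[OF that] by metis
  then have "(\<forall>k<Suc r. (v(r := u)) k \<in> E ((\<mu>(r := \<nu>)) k)) \<and>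
    (\<forall>k<Suc r. \<forall>l<Suc r. form ((v(r := u)) k) ((v(r := u)) l) = 0 \<longleftrightarrow> k \<noteq> l)"
    using v orth u by (auto simp: less_Suc_eq)
  then show ?case by blast
qed

text \<open>
  The columns of \<open>P\<close> are an orthogonal family of \<open>n\<close> anisotropic joint eigenvectors. Their
  linear independence comes from \<open>det (P\<^sup>T * B * P) \<noteq> 0\<close>.
\<close>

lemma simultaneous_congruence:
  obtains P where "P \<in> carrier_mat n n" "invertible_mat P"
    "diagonal_mat (P\<^sup>T * B * P)" "\<And>k. k < n \<Longrightarrow> (P\<^sup>T * B * P) $$ (k, k) \<noteq> 0"
    "\<And>i. i \<in> I \<Longrightarrow> diagonal_mat (P\<^sup>T * (B * M i) * P)"
proof -
  obtain v \<mu> where v: "\<And>k. k < n \<Longrightarrow> v k \<in> E (\<mu> k)"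
    and orth: "\<And>k l. k < n \<Longrightarrow> l < n \<Longrightarrow> form (v k) (v l) = 0 \<longleftrightarrow> k \<noteq> l"
    using orthogonal_family_exists[of n] by auto
  have vc: "v k \<in> carrier_vec n" if "k < n" for k using v[OF that] E_carrier by simp
  define P where "P = mat_of_cols n (map v [0..<n])"
  have P: "P \<in> carrier_mat n n" unfolding P_def by (rule carrier_matI) auto
  have col: "col P k = v k" if "k < n" for k
    unfolding P_def using that vc by (subst col_mat_of_cols) auto
  have entry: "(P\<^sup>T * A * P) $$ (k, l) = v k \<bullet> (A *\<^sub>v v l)"
    if A: "A \<in> carrier_mat n n" and k: "k < n" and l: "l < n" for A k l
  proof -
    have "P\<^sup>T * A * P = P\<^sup>T * (A * P)" using P A by (simp add: assoc_mult_mat[of _ n n _ n _ n])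
    moreover have "col (A * P) l = A *\<^sub>v v l" using A P l col[OF l] by (metis col_mult2)
    ultimately show ?thesis using P A k l col[OF k] by simp
  qed
  have dB: "diagonal_mat (P\<^sup>T * B * P)"
    unfolding diagonal_mat_def using P B entry[OF B] orth by auto
  have nz: "(P\<^sup>T * B * P) $$ (k, k) \<noteq> 0" if "k < n" for k
    using entry[OF B that that] orth[OF that that] by simp
  have dM: "diagonal_mat (P\<^sup>T * (B * M i) * P)" if i: "i \<in> I" for i
  proof -
    have BM: "B * M i \<in> carrier_mat n n" using B M[OF i] by simp
    have "(P\<^sup>T * (B * M i) * P) $$ (k, l) = \<mu> l i * form (v k) (v l)"
      if k: "k < n" and l: "l < n" for k l
      using entry[OF BM k l] form_eigenvector[OF vc[OF k] v[OF l] i] by simp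
    then show ?thesis
      unfolding diagonal_mat_def using P BM orth by auto
  qed
  have "det (P\<^sup>T * B * P) = prod_list (diag_mat (P\<^sup>T * B * P))"
    using P B dB
    by (intro det_upper_triangular[of _ n] upper_triangularI) (auto simp: diagonal_mat_def)
  moreover have "0 \<notin> set (diag_mat (P\<^sup>T * B * P))"
    using nz P by (auto simp: diag_mat_def)
  ultimately have "det (P\<^sup>T * B * P) \<noteq> 0" by (simp add: prod_list_zero_iff)
  then have "det P \<noteq> 0"
    using det_mult[of "P\<^sup>T * B" n P] P B by auto
  then have "P \<in> Units (ring_mat TYPE(real) n ())"
    by (rule det_non_zero_imp_unit[OF P])
  then have "invertible_mat P"
    using P by (auto simp: Units_def ring_mat_def invertible_mat_def inverts_mat_def)
  then show thesis using that P dB nz dM by blast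
qed

end

section \<open>From simultaneous diagonalization to the block form\<close>

lemma diag_block_mat_singletons:
  "diag_block_mat (map (\<lambda>t. mat 1 1 (\<lambda>_. f t)) xs)
    = mat (length xs) (length xs) (\<lambda>(i, j). if i = j then f (xs ! i) else 0)"
proof (induction xs)
  case Nil
  then show ?case by (intro eq_matI) auto
next
  case (Cons x xs)
  show ?case
    unfolding list.map diag_block_mat.simps Let_def Cons.IH
    by (rule eq_matI) (auto simp: less_Suc_eq_0_disj split: if_splits)
qed

text \<open>The shift \<open>t - 1\<close> translates between blocks counted from 1 and entries counted from 0.\<close>

lemma diagonal_mat_as_diag_block_mat:
  assumes D: "D \<in> carrier_mat n n" "diagonal_mat D"
  shows "D = diag_block_mat (map (\<lambda>t. mat 1 1 (\<lambda>_. D $$ (t - 1, t - 1))) [1..<Suc n])"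
  unfolding diag_block_mat_singletons
  using D by (intro eq_matI) (auto simp: diagonal_mat_def nth_upt simp del: upt_Suc)

lemma block_form_if_diagonal:
  assumes n: "n \<ge> 1" and C: "\<And>i. i \<in> {1..m} \<Longrightarrow> C i \<in> carrier_mat n n" and m: "m \<ge> 1"
    and P: "P \<in> carrier_mat n n" "invertible_mat P"
    and diag: "\<And>i. i \<in> {1..m} \<Longrightarrow> diagonal_mat (P\<^sup>T * C i * P)"
    and nz: "\<And>k. k < n \<Longrightarrow> (P\<^sup>T * C 1 * P) $$ (k, k) \<noteq> 0"
  shows "\<exists>A \<alpha>. block_form n m C P n A \<alpha>"
proof -
  define d where "d i t = (P\<^sup>T * C i * P) $$ (t - 1, t - 1)" for i t
  define A where "A t = mat 1 1 (\<lambda>_. d 1 t)" for t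
  define \<alpha> where "\<alpha> i t = d i t / d 1 t" for i t
  have PCP: "P\<^sup>T * C i * P = diag_block_mat (map (\<lambda>t. mat 1 1 (\<lambda>_. d i t)) [1..<Suc n])"
    if "i \<in> {1..m}" for i
    unfolding d_def using that C P diag by (intro diagonal_mat_as_diag_block_mat) auto
  have d1: "d 1 t \<noteq> 0" if "t \<in> {1..n}" for t
  proof -
    have "t - 1 < n" using that by auto
    then show ?thesis unfolding d_def by (rule nz)
  qed
  have "P\<^sup>T * C i * P = diag_block_mat (map (\<lambda>t. \<alpha> i t \<cdot>\<^sub>m A t) [1..<Suc n])"
    if i: "i \<in> {2..m}" for i
  proof -
    have "mat 1 1 (\<lambda>_. d i t) = \<alpha> i t \<cdot>\<^sub>m A t" if "t \<in> set [1..<Suc n]" for t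
      using d1[of t] that by (intro eq_matI) (auto simp: A_def \<alpha>_def)
    then have entries: "map (\<lambda>t. mat 1 1 (\<lambda>_. d i t)) [1..<Suc n] = map (\<lambda>t. \<alpha> i t \<cdot>\<^sub>m A t) [1..<Suc n]"
      by (rule map_cong[OF refl])
    have "i \<in> {1..m}" using i by simp
    from PCP[OF this] show ?thesis unfolding entries .
  qed
  moreover have "P\<^sup>T * C 1 * P = diag_block_mat (map A [1..<Suc n])"
    using PCP[of 1] m by (simp add: A_def[abs_def] del: upt_Suc)
  moreover have "invertible_mat (A t)" if "t \<in> {1..n}" for t
    unfolding invertible_mat_def
  proof (intro conjI exI)
    show "inverts_mat (A t) (mat 1 1 (\<lambda>_. 1 / d 1 t))"
      "inverts_mat (mat 1 1 (\<lambda>_. 1 / d 1 t)) (A t)"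
      unfolding inverts_mat_def using d1[OF that]
      by (auto simp: A_def scalar_prod_def intro!: eq_matI)
  qed (simp add: A_def)
  moreover have "symmetric_mat (A t)" for t
    unfolding symmetric_mat_def by (rule eq_matI) (auto simp: A_def)
  ultimately have "block_form n m C P n A \<alpha>"
    using P n unfolding block_form_def by (auto simp: A_def simp del: upt_Suc)
  then show ?thesis by blast
qed

theorem theorem1:
  fixes n m :: nat and C :: "nat \<Rightarrow> real mat"
  assumes "n \<ge> 1" and "m \<ge> 3"
    and "\<And>i. i \<in> {1..m} \<Longrightarrow> C i \<in> carrier_mat n n"
    and "\<And>i. i \<in> {1..m} \<Longrightarrow> symmetric_mat (C i)"
    and "invertible_mat (C 1)"
    and "\<And>i. i \<in> {2..m} \<Longrightarrow> real_similarly_diagonalizable n (inv_mat (C 1) * C i)"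
    and "\<And>i j. 2 \<le> i \<Longrightarrow> i < j \<Longrightarrow> j \<le> m \<Longrightarrow> symmetric_mat (C j * inv_mat (C 1) * C i)"
  shows "(\<exists>R s A \<alpha>. block_form n m C R s A \<alpha>) \<and>
         (\<forall>R s A \<alpha>. block_form n m C R s A \<alpha> \<longrightarrow> SDC n (C ` {1..m}))"
proof -
  define W where "W = inv_mat (C 1)"
  have C1: "C 1 \<in> carrier_mat n n" and C1_sym: "symmetric_mat (C 1)" using assms(2-4) by auto
  have C: "C i \<in> carrier_mat n n" and C_sym: "symmetric_mat (C i)" if "i \<in> {2..m}" for i
    using that assms(3,4) by auto
  have W: "W \<in> carrier_mat n n" and CW: "C 1 * W = 1\<^sub>m n"
    unfolding W_def using inv_mat[OF C1 assms(5)] by auto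
  have W_sym: "symmetric_mat W" using inverse_of_symmetric_mat[OF C1 W C1_sym CW] .
  have CM: "C 1 * (W * C i) = C i" if "i \<in> {2..m}" for i
    using assoc_mult_mat[OF C1 W C[OF that]] CW C[OF that] by simp
  have lt: "C j * W * C i = C i * W * C j"
    if i: "i \<in> {2..m}" and j: "j \<in> {2..m}" and ij: "i < j" for i j
  proof -
    have "C j * W * C i = (C j * W * C i)\<^sup>T"
      using assms(7)[of i j] i j ij by (simp add: symmetric_mat_def W_def)
    also have "\<dots> = (C i)\<^sup>T * (W\<^sup>T * (C j)\<^sup>T)"
      using C[OF i] C[OF j] W by (simp add: transpose_mult[of _ n n _ n])
    also have "\<dots> = C i * W * C j"
      using C_sym[OF i] C_sym[OF j] W_sym C[OF i] C[OF j] W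
      by (simp add: symmetric_mat_def assoc_mult_mat[of _ n n _ n _ n])
    finally show ?thesis .
  qed
  have comm: "(W * C i) * (W * C j) = (W * C j) * (W * C i)"
    if i: "i \<in> {2..m}" and j: "j \<in> {2..m}" for i j
  proof -
    have "C i * W * C j = C j * W * C i"
      using lt[OF i j] lt[OF j i] by (cases i j rule: linorder_cases) auto
    then have "W * (C i * W * C j) = W * (C j * W * C i)" by simp
    then show ?thesis
      using C[OF i] C[OF j] W by (simp add: assoc_mult_mat[of _ n n _ n _ n])
  qed
  interpret selfadjoint_family n "C 1" "{2..m}" "\<lambda>i. W * C i"
  proof
    fix y :: "real vec"
    assume y: "y \<in> carrier_vec n"
      "\<And>\<mu> v. v \<in> joint_eigenspace n {2..m} (\<lambda>i. W * C i) \<mu> \<Longrightarrow> y \<bullet> v = 0"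
    show "y = 0\<^sub>v n"
      using C W comm assms(6)
      by (intro joint_eigenvectors_span[of "{2..m}" "\<lambda>i. W * C i", OF _ _ _ _ y])
        (auto simp: W_def)
  qed (use C1 C1_sym assms(5) C W CM C_sym in auto)
  obtain P where P: "P \<in> carrier_mat n n" "invertible_mat P"
    and d1: "diagonal_mat (P\<^sup>T * C 1 * P)" "\<And>k. k < n \<Longrightarrow> (P\<^sup>T * C 1 * P) $$ (k, k) \<noteq> 0"
    and d2: "\<And>i. i \<in> {2..m} \<Longrightarrow> diagonal_mat (P\<^sup>T * (C 1 * (W * C i)) * P)"
    using simultaneous_congruence by blast
  have diag: "diagonal_mat (P\<^sup>T * C i * P)" if "i \<in> {1..m}" for i
    using that d1(1) d2[of i] CM[of i] by (cases "i = 1") auto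
  have "SDC n (C ` {1..m})" unfolding SDC_def using P diag by blast
  moreover have "\<exists>A \<alpha>. block_form n m C P n A \<alpha>"
    using assms(1-3) P diag d1(2) by (intro block_form_if_diagonal) auto
  ultimately show ?thesis by blast
qed

end
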